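(* Let $p$ be a prime and $r\ge1$ an integer. Let $f\in\mathbb{Q}[x]$ be a $p^r$-pure polynomial of degree $d>1$. Suppose $g(x)=bx^e+p^sh(x)\in\mathbb{Q}[x]$, with $e\ge1$, $\nu_p(b)=0$, $h\in\mathbb{Q}[x]$, $\deg(h)\le e-1$, $\nu_p(h)\ge0$, and $s$ an integer with $s>\frac{r}{d}$. Then $f\circ g$ is $p^r$-pure.
   Context: $\nu_p$ denotes the $p$-adic valuation on $\mathbb{Q}$ (with $\nu_p(0)=\infty$); for $h=\sum h_ix^i\in\mathbb{Q}[x]$, $\nu_p(h)=\min_i\nu_p(h_i)$. A polynomial $q(x)=a_nx^n+\dots+a_0\in\mathbb{Q}[x]$ of degree $n$ is $p^r$-pure if $\nu_p(a_n)=0$, $\nu_p(a_0)=r$, and $\frac{\nu_p(a_i)}{n-i}\ge\frac{r}{n}$ for all $1\le i\le n-1$. *)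

theory Defs
  imports
    "HOL-Computational_Algebra.Computational_Algebra"
    "HOL-Library.Extended_Real"
begin

definition padic_val :: "nat \<Rightarrow> rat \<Rightarrow> ereal" where
  "padic_val p x =
     (if x = 0 then \<infinity>
      else let (a, b) = quotient_of x in
        ereal (real (multiplicity (int p) a) - real (multiplicity (int p) b)))"

definition padic_val_poly :: "nat \<Rightarrow> rat poly \<Rightarrow> ereal" where
  "padic_val_poly p h = Min ((\<lambda>i. padic_val p (coeff h i)) ` {..degree h})"

definition pure_poly :: "nat \<Rightarrow> int \<Rightarrow> rat poly \<Rightarrow> bool" where
  "pure_poly p r q \<longleftrightarrow>
     padic_val p (lead_coeff q) = 0 \<and>
     padic_val p (coeff q 0) = ereal (of_int r) \<and>
     (\<forall>i\<in>{1..degree q - 1}.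
        padic_val p (coeff q i) / ereal (real (degree q - i))
          \<ge> ereal (of_int r / real (degree q)))"

end

theory Submission
  imports Defs
begin

text \<open>For a slope \<open>l\<close>, the weighted Gauss valuation \<open>w\<^sub>l(q) = min\<^sub>i (\<nu>\<^sub>p(q\<^sub>i) + i l)\<close> is superadditive
  under products, and \<open>w\<^sub>t(f) \<le> w\<^sub>l(f \<circ> g)\<close> whenever \<open>t \<le> w\<^sub>l(g)\<close>. For \<open>q\<close> of degree \<open>n > 0\<close> with the
  prescribed end coefficients, purity means \<open>w\<^sub>l(q) \<ge> r\<close> for \<open>l = r / n\<close>. The hypotheses on \<open>g\<close> give
  \<open>w\<^sub>l(g) \<ge> r / d\<close> for \<open>l = r / (d e)\<close>, so the slope condition passes from \<open>f\<close> to \<open>f \<circ> g\<close>.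
  Since \<open>\<nu>\<^sub>p(g(0)) \<ge> s > r / d\<close>, the constant term of \<open>f\<close> strictly dominates in \<open>f(g(0))\<close>.\<close>

lemma rat_common_denominator:
  fixes x y :: rat
  obtains a b c :: int where "c \<noteq> 0" "x = of_int a / of_int c" "y = of_int b / of_int c"
proof -
  obtain a m where x: "quotient_of x = (a, m)" by fastforce
  obtain b n where y: "quotient_of y = (b, n)" by fastforce
  show ?thesis
  proof (rule that)
    show "m * n \<noteq> 0"
      using x y by (auto dest: quotient_of_denom_pos)
    then show "x = of_int (a * n) / of_int (m * n)" "y = of_int (b * m) / of_int (m * n)"
      using quotient_of_div[OF x] quotient_of_div[OF y] by auto
  qed
qed

lemma degree_add_monom:
  assumes "degree q < n" "b \<noteq> 0"
  shows "degree (q + monom b n) = n"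
  using assms by (simp add: degree_add_eq_right degree_monom_eq)

lemma lead_coeff_add_monom:
  assumes "degree q < n" "b \<noteq> 0"
  shows "lead_coeff (q + monom b n) = b"
  using assms by (simp add: degree_add_monom coeff_eq_0)

lemma padic_val_eq_infinity_iff [simp]: "padic_val p x = \<infinity> \<longleftrightarrow> x = 0"
  by (simp add: padic_val_def split: prod.split)

lemma padic_val_neq_minus_infinity [simp]: "padic_val p x \<noteq> -\<infinity>"
  by (simp add: padic_val_def split: prod.split)

lemma padic_val_0 [simp]: "padic_val p 0 = \<infinity>"
  by simp

lemma padic_val_poly_le_coeff: "padic_val_poly p h \<le> padic_val p (coeff h i)"
proof (cases "i \<le> degree h")
  case True
  then show ?thesis
    unfolding padic_val_poly_def by (intro Min_le) auto
qed (simp add: coeff_eq_0)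

text \<open>The library's \<open>min_add_distrib_left\<close> assumes cancellation, which \<^typ>\<open>ereal\<close> lacks.\<close>

lemma min_plus_distrib_left:
  fixes x y z :: "'a :: {linorder, ordered_ab_semigroup_add}"
  shows "min x y + z = min (x + z) (y + z)"
  using min_of_mono[of "\<lambda>x. x + z" x y] by (simp add: monoI add_right_mono)

definition gauss_val :: "nat \<Rightarrow> real \<Rightarrow> rat poly \<Rightarrow> ereal" where
  "gauss_val p l q = (INF i. padic_val p (coeff q i) + ereal (real i * l))"

lemma le_gauss_val_iff:
  "u \<le> gauss_val p l q \<longleftrightarrow> (\<forall>i. u \<le> padic_val p (coeff q i) + ereal (real i * l))"
  by (simp add: gauss_val_def le_INF_iff)

lemma gauss_val_le_coeff: "gauss_val p l q \<le> padic_val p (coeff q i) + ereal (real i * l)"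
  using le_gauss_val_iff by blast

lemma gauss_val_0 [simp]: "gauss_val p l 0 = \<infinity>"
  by (simp add: gauss_val_def)

lemma gauss_val_pCons:
  "gauss_val p l (pCons a q) = min (padic_val p a) (ereal l + gauss_val p l q)"
proof -
  have shift: "u \<le> padic_val p c + ereal (real (Suc i) * l) \<longleftrightarrow>
      u - ereal l \<le> padic_val p c + ereal (real i * l)" for u c i
  proof -
    have split: "padic_val p c + ereal (real (Suc i) * l) =
        padic_val p c + ereal (real i * l) + ereal l"
      by (simp add: add.assoc distrib_right add.commute[of l])
    show ?thesis
      by (subst split, subst ereal_minus_le) simp_all
  qed
  have "u \<le> gauss_val p l (pCons a q) \<longleftrightarrow> u \<le> padic_val p a \<and> u \<le> ereal l + gauss_val p l q" for u
  proof -
    have "u \<le> gauss_val p l (pCons a q) \<longleftrightarrow>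
        u \<le> padic_val p a \<and> (\<forall>i. u \<le> padic_val p (coeff q i) + ereal (real (Suc i) * l))"
      by (auto simp: le_gauss_val_iff coeff_pCons split: nat.splits)
    also have "\<dots> \<longleftrightarrow> u \<le> padic_val p a \<and> u - ereal l \<le> gauss_val p l q"
      by (simp only: shift le_gauss_val_iff)
    also have "\<dots> \<longleftrightarrow> u \<le> padic_val p a \<and> u \<le> ereal l + gauss_val p l q"
      by (simp add: ereal_minus_le add.commute)
    finally show ?thesis .
  qed
  then show ?thesis
    by (meson min.boundedI min.cobounded1 min.cobounded2 order.antisym order.refl)
qed

lemma gauss_val_const: "gauss_val p l [:a:] = padic_val p a"
  by (simp add: gauss_val_pCons)

lemma gauss_val_monom: "gauss_val p l (monom a n) = padic_val p a + ereal (real n * l)"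
proof (induction n)
  case 0
  then show ?case by (simp add: monom_0 gauss_val_const)
next
  case (Suc n)
  then show ?case
    by (simp add: monom_Suc gauss_val_pCons algebra_simps flip: plus_ereal.simps(1))
qed

lemma padic_val_poly_le_gauss_val:
  assumes "l \<ge> 0"
  shows "padic_val_poly p q \<le> gauss_val p l q"
  unfolding le_gauss_val_iff
  using assms by (intro allI add_increasing2 padic_val_poly_le_coeff) simp

lemma gauss_val_slope_0: "gauss_val p 0 q = padic_val_poly p q"
proof (rule antisym)
  have "gauss_val p 0 q \<le> padic_val p (coeff q i)" for i
    using gauss_val_le_coeff[of p 0 q i] by simp
  then show "gauss_val p 0 q \<le> padic_val_poly p q"
    unfolding padic_val_poly_def by (intro Min.boundedI) auto
qed (simp add: padic_val_poly_le_gauss_val)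

lemma pure_poly_iff_gauss_val:
  assumes "degree q > 0"
  shows "pure_poly p r q \<longleftrightarrow>
    padic_val p (lead_coeff q) = 0 \<and>
    padic_val p (coeff q 0) = ereal (of_int r) \<and>
    ereal (of_int r) \<le> gauss_val p (of_int r / real (degree q)) q"
proof -
  define n where "n = degree q"
  define l where "l = of_int r / real n"
  have nl: "real n * l = of_int r"
    using assms by (simp add: n_def l_def)
  have slope: "ereal l \<le> padic_val p (coeff q i) / ereal (real (n - i)) \<longleftrightarrow>
      ereal (of_int r) \<le> padic_val p (coeff q i) + ereal (real i * l)"
    if "i \<in> {1..n - 1}" for i
  proof -
    have "i \<le> n"
      using that by auto
    then obtain k where n: "n = i + k"
      using le_Suc_ex by blast
    have "real k * l = of_int r - real i * l"
      using nl by (simp add: n distrib_right)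
    moreover have "real k > 0"
      using that by (auto simp: n)
    ultimately show ?thesis
      by (simp add: n ereal_le_divide_pos ereal_minus_le flip: ereal_minus(1))
  qed
  have ends: "ereal (of_int r) \<le> padic_val p (coeff q i) + ereal (real i * l)"
    if "padic_val p (lead_coeff q) = 0" "padic_val p (coeff q 0) = ereal (of_int r)"
      and "i \<notin> {1..n - 1}" for i
  proof -
    consider "i = 0" | "i = n" | "i > n"
      using \<open>i \<notin> {1..n - 1}\<close> by fastforce
    then show ?thesis
      using that nl by cases (auto simp: n_def coeff_eq_0)
  qed
  show ?thesis
    unfolding pure_poly_def le_gauss_val_iff n_def[symmetric] l_def[symmetric]
    using slope ends n_def by metis
qed

context
  fixes p :: nat
  assumes prime: "prime p"
begin

lemma padic_val_divide_of_int:
  assumes "a \<noteq> 0" "b \<noteq> 0"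
  shows "padic_val p (of_int a / of_int b) =
    ereal (real (multiplicity (int p) a) - real (multiplicity (int p) b))"
proof -
  define x :: rat where "x = of_int a / of_int b"
  obtain n m where quot: "quotient_of x = (n, m)"
    by fastforce
  have m: "m > 0" and x: "x = of_int n / of_int m"
    using quotient_of_denom_pos[OF quot] quotient_of_div[OF quot] .
  have "x \<noteq> 0"
    using assms by (simp add: x_def)
  then have n: "n \<noteq> 0"
    using x by auto
  have "(of_int (a * m) :: rat) = of_int (n * b)"
    using x assms m unfolding x_def by (simp add: field_simps)
  then have "multiplicity (int p) (a * m) = multiplicity (int p) (n * b)"
    by (simp only: of_int_eq_iff)
  then have "multiplicity (int p) a + multiplicity (int p) m =
      multiplicity (int p) n + multiplicity (int p) b"
    using assms m n prime by (simp add: prime_elem_multiplicity_mult_distrib)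
  then have "real (multiplicity (int p) a) - real (multiplicity (int p) b) =
      real (multiplicity (int p) n) - real (multiplicity (int p) m)"
    by linarith
  then show ?thesis
    using \<open>x \<noteq> 0\<close> quot by (simp add: padic_val_def flip: x_def)
qed

lemma padic_val_of_int:
  "a \<noteq> 0 \<Longrightarrow> padic_val p (of_int a) = ereal (real (multiplicity (int p) a))"
  using padic_val_divide_of_int[of a 1] by simp

lemma padic_val_1: "padic_val p 1 = 0"
  using padic_val_of_int[of 1] by simp

lemma padic_val_prime: "padic_val p (of_nat p) = 1"
  using padic_val_of_int[of "int p"] prime by (simp add: prime_gt_0_nat one_ereal_def)

lemma padic_val_mult: "padic_val p (x * y) = padic_val p x + padic_val p y"
proof (cases "x = 0 \<or> y = 0")
  case False
  obtain a b c where c: "c \<noteq> 0" and xy: "x = of_int a / of_int c" "y = of_int b / of_int c"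
    by (rule rat_common_denominator)
  have "a \<noteq> 0" "b \<noteq> 0"
    using False xy by auto
  have product: "x * y = of_int (a * b) / of_int (c * c)"
    using xy by simp
  show ?thesis
    unfolding product unfolding xy using \<open>a \<noteq> 0\<close> \<open>b \<noteq> 0\<close> c prime
    by (simp add: padic_val_divide_of_int prime_elem_multiplicity_mult_distrib del: of_int_mult)
qed auto

lemma padic_val_add_ge: "min (padic_val p x) (padic_val p y) \<le> padic_val p (x + y)"
proof (cases "x = 0 \<or> y = 0 \<or> x + y = 0")
  case False
  obtain a b c where c: "c \<noteq> 0" and xy: "x = of_int a / of_int c" "y = of_int b / of_int c"
    by (rule rat_common_denominator)
  have sum: "x + y = of_int (a + b) / of_int c"
    using xy by (simp add: add_divide_distrib)
  have nonzero: "a \<noteq> 0" "b \<noteq> 0" "a + b \<noteq> 0"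
    using False xy sum by auto
  let ?k = "min (multiplicity (int p) a) (multiplicity (int p) b)"
  have "int p ^ ?k dvd a + b"
    by (intro dvd_add multiplicity_dvd') auto
  then have "?k \<le> multiplicity (int p) (a + b)"
    using nonzero prime by (intro multiplicity_geI) (auto simp: prime_gt_1_nat)
  then show ?thesis
    unfolding sum unfolding xy using c nonzero
    by (auto simp: padic_val_divide_of_int min_def simp del: of_int_add split: if_splits)
qed auto

lemma padic_val_uminus: "padic_val p (- x) = padic_val p x"
  using padic_val_mult[of "-1" x] padic_val_of_int[of "-1"]
  by (simp add: multiplicity_unit_right flip: zero_ereal_def)

lemma padic_val_add_eq_left:
  assumes "padic_val p x < padic_val p y"
  shows "padic_val p (x + y) = padic_val p x"
proof (rule antisym)
  have "min (padic_val p (x + y)) (padic_val p y) \<le> padic_val p x"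
    using padic_val_add_ge[of "x + y" "- y"] by (simp add: padic_val_uminus)
  then show "padic_val p (x + y) \<le> padic_val p x"
    using assms by (auto simp: min_le_iff_disj)
  show "padic_val p x \<le> padic_val p (x + y)"
    using padic_val_add_ge[of x y] assms by simp
qed

lemma padic_val_power: "padic_val p (x ^ n) = ereal (real n) * padic_val p x"
proof (induction n)
  case 0
  show ?case by (simp add: padic_val_1)
next
  case (Suc n)
  have "padic_val p x + ereal (real n) * padic_val p x = (1 + ereal (real n)) * padic_val p x"
    by (subst ereal_left_distrib) simp_all
  then show ?case
    by (simp add: padic_val_mult Suc one_ereal_def)
qed

lemma padic_val_inverse:
  assumes "x \<noteq> 0"
  shows "padic_val p (inverse x) = - padic_val p x"
proof -
  have "padic_val p x + padic_val p (inverse x) = 0"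
    using assms padic_val_mult[of x "inverse x"] by (simp add: padic_val_1)
  then show ?thesis
    by (cases "padic_val p x"; cases "padic_val p (inverse x)") auto
qed

lemma padic_val_prime_powi: "padic_val p (of_nat p powi k) = ereal (of_int k)"
  using prime_gt_0_nat[OF prime]
  by (simp add: power_int_def padic_val_power padic_val_inverse padic_val_prime)

lemma gauss_val_add_ge: "min (gauss_val p l q) (gauss_val p l q') \<le> gauss_val p l (q + q')"
  unfolding le_gauss_val_iff
proof
  fix i
  let ?m = "ereal (real i * l)"
  have "min (gauss_val p l q) (gauss_val p l q') \<le>
      min (padic_val p (coeff q i) + ?m) (padic_val p (coeff q' i) + ?m)"
    by (intro min.mono gauss_val_le_coeff)
  also have "\<dots> = min (padic_val p (coeff q i)) (padic_val p (coeff q' i)) + ?m"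
    by (simp add: min_plus_distrib_left)
  also have "\<dots> \<le> padic_val p (coeff (q + q') i) + ?m"
    by (simp add: padic_val_add_ge add_right_mono)
  finally show "min (gauss_val p l q) (gauss_val p l q') \<le> padic_val p (coeff (q + q') i) + ?m" .
qed

lemma gauss_val_smult_ge: "padic_val p c + gauss_val p l q \<le> gauss_val p l (smult c q)"
  unfolding le_gauss_val_iff
  by (auto simp: padic_val_mult add.assoc intro: add_left_mono gauss_val_le_coeff)

lemma padic_val_poly_smult_ge: "padic_val p c + padic_val_poly p q \<le> padic_val_poly p (smult c q)"
  using gauss_val_smult_ge[of c 0 q] by (simp add: gauss_val_slope_0)

lemma gauss_val_mult_ge: "gauss_val p l q + gauss_val p l q' \<le> gauss_val p l (q * q')"
proof (induction q)
  case 0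
  show ?case by simp
next
  case (pCons a q)
  have "gauss_val p l (pCons a q) + gauss_val p l q' =
      min (padic_val p a + gauss_val p l q') (ereal l + (gauss_val p l q + gauss_val p l q'))"
    by (simp add: gauss_val_pCons min_plus_distrib_left add.assoc)
  also have "\<dots> \<le> min (gauss_val p l (smult a q')) (ereal l + gauss_val p l (q * q'))"
    by (intro min.mono gauss_val_smult_ge add_left_mono pCons.IH)
  also have "\<dots> = min (gauss_val p l (smult a q')) (gauss_val p l (pCons 0 (q * q')))"
    by (simp add: gauss_val_pCons)
  also have "\<dots> \<le> gauss_val p l (pCons a q * q')"
    using gauss_val_add_ge by simp
  finally show ?case .
qed

lemma gauss_val_pcompose_ge:
  assumes "ereal t \<le> gauss_val p l g"
  shows "gauss_val p t f \<le> gauss_val p l (f \<circ>\<^sub>p g)"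
proof (induction f)
  case 0
  show ?case by simp
next
  case (pCons a f)
  have "gauss_val p t (pCons a f) \<le>
      min (padic_val p a) (gauss_val p l g + gauss_val p l (f \<circ>\<^sub>p g))"
    unfolding gauss_val_pCons by (intro min.mono add_mono order.refl assms pCons.IH)
  also have "\<dots> \<le> min (gauss_val p l [:a:]) (gauss_val p l (g * (f \<circ>\<^sub>p g)))"
    by (intro min.mono gauss_val_mult_ge) (simp add: gauss_val_const)
  also have "\<dots> \<le> gauss_val p l (pCons a f \<circ>\<^sub>p g)"
    unfolding pcompose_pCons by (rule gauss_val_add_ge)
  finally show ?case .
qed

lemma gauss_val_le_padic_val_eval:
  assumes "ereal t \<le> padic_val p c"
  shows "gauss_val p t f \<le> padic_val p (poly f c)"
  using gauss_val_pcompose_ge[of t 0 "[:c:]" f] assms by (simp add: gauss_val_const pcompose_pCons_0)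

lemma padic_val_eval_eq_coeff_0:
  assumes "coeff f 0 \<noteq> 0" "padic_val p (coeff f 0) \<le> gauss_val p t f" "ereal t < padic_val p c"
  shows "padic_val p (poly f c) = padic_val p (coeff f 0)"
proof (cases f)
  case (pCons a q)
  have "padic_val p a \<le> ereal t + gauss_val p t q"
    using assms(2) by (simp add: pCons gauss_val_pCons)
  also have "\<dots> \<le> ereal t + padic_val p (poly q c)"
    using assms(3) by (intro add_left_mono gauss_val_le_padic_val_eval) simp
  finally have "padic_val p a \<le> ereal t + padic_val p (poly q c)" .
  moreover have "a \<noteq> 0"
    using assms(1) by (simp add: pCons)
  ultimately have "padic_val p a < padic_val p c + padic_val p (poly q c)"
    using assms(3)
    by (cases "padic_val p a"; cases "padic_val p c"; cases "padic_val p (poly q c)") auto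
  then show ?thesis
    by (simp add: pCons padic_val_add_eq_left padic_val_mult)
qed

lemma pure_poly_pcompose:
  assumes pure: "pure_poly p r f" and deg: "degree f > 0" "degree g > 0"
    and lead: "padic_val p (lead_coeff g) = 0"
    and slope: "ereal (of_int r / real (degree f))
      \<le> gauss_val p (of_int r / real (degree f * degree g)) g"
    and const: "ereal (of_int r / real (degree f)) < padic_val p (coeff g 0)"
  shows "pure_poly p r (f \<circ>\<^sub>p g)"
proof -
  have f: "padic_val p (lead_coeff f) = 0" "padic_val p (coeff f 0) = ereal (of_int r)"
    "ereal (of_int r) \<le> gauss_val p (of_int r / real (degree f)) f"
    using pure deg by (simp_all add: pure_poly_iff_gauss_val)
  have "padic_val p (lead_coeff (f \<circ>\<^sub>p g)) = 0"
    by (simp add: lead_coeff_comp deg padic_val_mult padic_val_power f lead)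
  moreover have "padic_val p (coeff (f \<circ>\<^sub>p g) 0) = ereal (of_int r)"
  proof -
    have "coeff f 0 \<noteq> 0"
      using f(2) by auto
    then have "padic_val p (poly f (coeff g 0)) = padic_val p (coeff f 0)"
      using f const by (intro padic_val_eval_eq_coeff_0) auto
    then show ?thesis
      by (simp add: f)
  qed
  moreover have "ereal (of_int r) \<le> gauss_val p (of_int r / real (degree f * degree g)) (f \<circ>\<^sub>p g)"
    using f(3) gauss_val_pcompose_ge[OF slope] by (rule order.trans)
  ultimately show ?thesis
    using deg by (simp add: pure_poly_iff_gauss_val degree_pcompose)
qed

lemma pure_poly_pcompose_add_monom:
  assumes "pure_poly p r f" "r \<ge> 0" "degree f > 0"
    and deg: "degree u < e" and b: "padic_val p b = 0"
    and dominated: "ereal (of_int r / real (degree f)) < padic_val_poly p u"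
  shows "pure_poly p r (f \<circ>\<^sub>p (u + monom b e))"
proof (rule pure_poly_pcompose)
  let ?t = "of_int r / real (degree f)" and ?l = "of_int r / real (degree f * e)"
  have "b \<noteq> 0"
    using b by auto
  note g = degree_add_monom[OF deg \<open>b \<noteq> 0\<close>] lead_coeff_add_monom[OF deg \<open>b \<noteq> 0\<close>]
  show "degree (u + monom b e) > 0" "padic_val p (lead_coeff (u + monom b e)) = 0"
    using deg b g by simp_all
  have "ereal ?t < gauss_val p ?l u"
    using \<open>r \<ge> 0\<close> by (intro less_le_trans[OF dominated] padic_val_poly_le_gauss_val) simp
  moreover have "gauss_val p ?l (monom b e) = ereal ?t"
    using deg b by (simp add: gauss_val_monom)
  ultimately have "ereal ?t \<le> gauss_val p ?l (u + monom b e)"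
    using gauss_val_add_ge[of ?l u "monom b e"] by (simp add: min_absorb2 less_imp_le)
  then show "ereal ?t \<le> gauss_val p (of_int r / real (degree f * degree (u + monom b e)))
      (u + monom b e)"
    by (simp add: g)
  show "ereal ?t < padic_val p (coeff (u + monom b e) 0)"
    using less_le_trans[OF dominated padic_val_poly_le_coeff[of p u 0]] deg by simp
qed (use assms in simp_all)

end

theorem theorem3p7:
  fixes p e :: nat and r s :: int and f g h :: "rat poly" and b :: rat
  assumes "prime p"
    and "r \<ge> 1"
    and "pure_poly p r f"
    and "degree f > 1"
    and "g = monom b e + smult (of_nat p powi s) h"
    and "e \<ge> 1"
    and "padic_val p b = 0"
    and "degree h \<le> e - 1"
    and "padic_val_poly p h \<ge> 0"
    and "real_of_int s > real_of_int r / real (degree f)"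
  shows "pure_poly p r (f \<circ>\<^sub>p g)"
proof -
  let ?u = "smult (of_nat p powi s) h"
  have "ereal (of_int r / real (degree f)) < ereal (of_int s)"
    using assms(10) by simp
  also have "\<dots> \<le> padic_val p (of_nat p powi s) + padic_val_poly p h"
    using assms(9) by (simp add: padic_val_prime_powi[OF assms(1)] add_increasing2)
  also have "\<dots> \<le> padic_val_poly p ?u"
    using assms(1) by (rule padic_val_poly_smult_ge)
  finally have "ereal (of_int r / real (degree f)) < padic_val_poly p ?u" .
  moreover have "degree ?u < e"
    using assms(6,8) by auto
  ultimately have "pure_poly p r (f \<circ>\<^sub>p (?u + monom b e))"
    using assms(1-4,7) by (intro pure_poly_pcompose_add_monom) simp_all
  then show ?thesis
    by (simp add: assms(5) add.commute)
qed

end
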